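(* For every positive integer $k$, $$c_k \geq 1 - \frac{2}{k!}\sum^{\lfloor k/3 \rfloor}_{i=0} (-1)^i \binom{k}{i} \left(\frac{k}{3}-i\right)^k.$$
   Context: A subset $A$ of an additive group is called sumfree if $x+y\neq z$ for all $x,y,z\in A$ (not necessarily distinct). For a positive integer $k$, subsets of $\{1,\ldots,n\}^k$ are regarded as subsets of the additive group $\mathbb{Z}^k$, and $$c_k := \limsup_{n \to \infty} \frac{1}{n^k} \max \{\#S : S \subset \{1,\ldots,n\}^k \text{ is sumfree}\}.$$ *)

theory Defs
  imports Complex_Main "HOL-Library.Extended_Real" "HOL-Library.Function_Algebras"
begin

definition sumfree :: "'a::ab_group_add set \<Rightarrow> bool" where
  "sumfree A \<longleftrightarrow> (\<forall>x\<in>A. \<forall>y\<in>A. \<forall>z\<in>A. x + y \<noteq> z)"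

(* Since k varies over nat, Z^k is realised as the subgroup of the pointwise additive group
   nat => int consisting of the functions that vanish at all indices >= k; the coordinates
   are indexed by 0, ..., k - 1. *)

definition int_cube :: "nat \<Rightarrow> nat \<Rightarrow> (nat \<Rightarrow> int) set" where
  "int_cube k n = {x. (\<forall>i<k. x i \<in> {1..int n}) \<and> (\<forall>i\<ge>k. x i = 0)}"

definition max_sumfree :: "nat \<Rightarrow> nat \<Rightarrow> nat" where
  "max_sumfree k n = Max {card S | S. S \<subseteq> int_cube k n \<and> sumfree S}"

(* The limit superior is taken in the complete lattice ereal; the term at n = 0
   (where the quotient is 0 for k > 0 by the convention x / 0 = 0) is irrelevant. *)
definition c_sumfree :: "nat \<Rightarrow> ereal" where
  "c_sumfree k = limsup (\<lambda>n. ereal (real (max_sumfree k n) / real n ^ k))"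

end

theory Submission
  imports Defs
begin

text \<open>
  If a set of points of \<open>\<int>\<^sup>k\<close> has all its coordinate sums in \<open>[u, 2u)\<close>, it is sumfree. For
  \<open>n + 1 = 3m\<close> and \<open>u = km\<close> the reflection \<open>x \<mapsto> n + 1 - x\<close> exchanges the coordinate sums \<open>\<ge> 2u\<close>
  with those \<open>\<le> u\<close>, so at most twice the number of points with coordinate sum \<open>\<le> u\<close> is lost
  from the cube. By inclusion-exclusion, that number is exactly
  \<open>\<Sum>i\<le>k. (-1)\<^sup>i (k choose i) (u - n i choose k)\<close>, where terms with \<open>u < n i\<close> are dropped; divided
  by \<open>n\<^sup>k\<close> this tends to the Irwin--Hall distribution function at \<open>k / 3\<close>.
\<close>

section \<open>Points of bounded coordinate sum, one coordinate at a time\<close>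

text \<open>The bound \<open>s\<close> is an integer so that the recursion on the dimension can
  subtract a coordinate without truncation; a negative \<open>s\<close> gives the empty set.\<close>

definition low_part :: "nat \<Rightarrow> nat \<Rightarrow> int \<Rightarrow> (nat \<Rightarrow> int) set" where
  "low_part k n s = {x \<in> int_cube k n. (\<Sum>i<k. x i) \<le> s}"

lemma int_cube_0: "int_cube 0 n = {0}"
  by (auto simp: int_cube_def fun_eq_iff)

lemma fun_upd_mem_int_cube:
  "x \<in> int_cube k n \<Longrightarrow> j \<in> {1..n} \<Longrightarrow> x(k := int j) \<in> int_cube (Suc k) n"
  by (auto simp: int_cube_def)

lemma fun_upd_0_mem_int_cube:
  "x \<in> int_cube (Suc k) n \<Longrightarrow> x(k := 0) \<in> int_cube k n"
  by (auto simp: int_cube_def)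

lemma sum_fun_upd_lessThan: "(\<Sum>i<k. (x(k := v)) i) = (\<Sum>i<k. x i)"
  for x :: "nat \<Rightarrow> int"
  by (rule sum.cong) auto

lemma int_cube_last:
  assumes "x \<in> int_cube (Suc k) n"
  obtains j where "j \<in> {1..n}" "x k = int j"
proof
  have "x k \<in> {1..int n}" using assms by (auto simp: int_cube_def)
  then show "nat (x k) \<in> {1..n}" "x k = int (nat (x k))" by auto
qed

text \<open>Points of \<open>int_cube k n\<close> all vanish at index \<open>k\<close>, so
  overwriting that value loses no information.\<close>

lemma inj_on_extend_int_cube:
  "inj_on (\<lambda>(j, x). x(k := int j)) (UNIV \<times> int_cube k n)"
proof (rule inj_onI, clarsimp)
  fix i j :: nat and x y assume xy: "x \<in> int_cube k n" "y \<in> int_cube k n"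
    and eq: "x(k := int i) = y(k := int j)"
  have "x l = y l" for l
    using fun_cong[OF eq, of l] xy by (cases "l = k") (auto simp: int_cube_def)
  then show "i = j \<and> x = y"
    using fun_cong[OF eq, of k] by auto
qed

lemma int_cube_Suc: "int_cube (Suc k) n = (\<lambda>(j, x). x(k := int j)) ` ({1..n} \<times> int_cube k n)"
proof (intro equalityI subsetI)
  fix x assume x: "x \<in> int_cube (Suc k) n"
  then obtain j where j: "j \<in> {1..n}" "x k = int j" by (rule int_cube_last)
  show "x \<in> (\<lambda>(j, x). x(k := int j)) ` ({1..n} \<times> int_cube k n)"
    using j fun_upd_0_mem_int_cube[OF x]
    by (intro image_eqI[of _ _ "(j, x(k := 0))"]) (auto simp: fun_eq_iff)
qed (auto intro: fun_upd_mem_int_cube[simplified])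

lemma low_part_Suc:
  "low_part (Suc k) n s = (\<lambda>(j, x). x(k := int j)) ` (SIGMA j:{1..n}. low_part k n (s - int j))"
proof (intro equalityI subsetI)
  fix x assume x: "x \<in> low_part (Suc k) n s"
  then obtain j where j: "j \<in> {1..n}" "x k = int j"
    unfolding low_part_def by (blast elim: int_cube_last)
  have "x(k := 0) \<in> low_part k n (s - int j)"
    using x j fun_upd_0_mem_int_cube[of x k n]
    unfolding low_part_def mem_Collect_eq sum_fun_upd_lessThan by auto
  then show "x \<in> (\<lambda>(j, x). x(k := int j)) ` (SIGMA j:{1..n}. low_part k n (s - int j))"
    using j by (intro image_eqI[of _ _ "(j, x(k := 0))"]) (auto simp: fun_eq_iff)
next
  fix y assume "y \<in> (\<lambda>(j, x). x(k := int j)) ` (SIGMA j:{1..n}. low_part k n (s - int j))"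
  then obtain j x where "y = x(k := int j)" "j \<in> {1..n}" "x \<in> low_part k n (s - int j)"
    by auto
  then show "y \<in> low_part (Suc k) n s"
    using fun_upd_mem_int_cube[of x k n j] sum_fun_upd_lessThan[of x k "int j"]
    by (auto simp: low_part_def simp del: fun_upd_apply) simp
qed

lemma finite_int_cube: "finite (int_cube k n)"
  by (induction k) (auto simp: int_cube_0 int_cube_Suc)

lemma finite_low_part: "finite (low_part k n s)"
  unfolding low_part_def using finite_int_cube by auto

lemma card_int_cube: "card (int_cube k n) = n ^ k"
proof (induction k)
  case (Suc k)
  show ?case
    unfolding int_cube_Suc
    by (subst card_image)
      (auto intro: inj_on_subset[OF inj_on_extend_int_cube] simp: Suc card_cartesian_product)
qed (simp add: int_cube_0)

lemma card_low_part_Suc: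
  "card (low_part (Suc k) n s) = (\<Sum>j=1..n. card (low_part k n (s - int j)))"
proof -
  have "inj_on (\<lambda>(j, x). x(k := int j)) (SIGMA j:{1..n}. low_part k n (s - int j))"
    by (rule inj_on_subset[OF inj_on_extend_int_cube[of k n]]) (auto simp: low_part_def)
  then show ?thesis
    unfolding low_part_Suc by (subst card_image) (auto simp: finite_low_part)
qed

section \<open>Exact count by inclusion-exclusion\<close>

text \<open>With \<open>nat t choose k\<close> alone, the case \<open>k = 0\<close> would be 1 at negative \<open>t\<close>, and
  \<open>int_choose_diff\<close> would fail there.\<close>

definition int_choose :: "int \<Rightarrow> nat \<Rightarrow> int" where
  "int_choose t k = (if t < 0 then 0 else int (nat t choose k))"

text \<open>Pascal's rule if \<open>t \<ge> 1\<close>; otherwise all three terms vanish.\<close>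

lemma int_choose_diff: "int_choose t (Suc k) - int_choose (t - 1) (Suc k) = int_choose (t - 1) k"
proof (cases "t \<ge> 1")
  case True
  then have "nat t = Suc (nat (t - 1))" by auto
  then show ?thesis using True by (simp add: int_choose_def)
qed (auto simp: int_choose_def)

text \<open>Hockey-stick identity: by \<open>int_choose_diff\<close> the sum telescopes.\<close>

lemma sum_int_choose:
  "(\<Sum>j=1..n. int_choose (t - int j) k) = int_choose t (Suc k) - int_choose (t - int n) (Suc k)"
proof (induction n)
  case (Suc n)
  then show ?case
    using int_choose_diff[of "t - int n" k] by (simp add: algebra_simps)
qed simp

text \<open>With E the shift of sequences, both sides are \<open>(1 - E) ^ Suc k\<close> applied to
  \<open>g\<close>, evaluated at 0.\<close>

lemma alternating_binomial_sum_Suc: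
  fixes g :: "nat \<Rightarrow> 'a::comm_ring_1"
  shows "(\<Sum>i\<le>k. (-1) ^ i * of_nat (k choose i) * (g i - g (Suc i)))
       = (\<Sum>i\<le>Suc k. (-1) ^ i * of_nat (Suc k choose i) * g i)"
proof -
  have "(\<Sum>i\<le>Suc k. (-1) ^ i * of_nat (Suc k choose i) * g i)
      = g 0 + (\<Sum>i\<le>k. (-1) ^ Suc i * of_nat (k choose Suc i) * g (Suc i))
            - (\<Sum>i\<le>k. (-1) ^ i * of_nat (k choose i) * g (Suc i))"
    by (subst sum.atMost_Suc_shift)
      (simp add: algebra_simps sum.distrib sum_negf sum_subtractf)
  also have "g 0 + (\<Sum>i\<le>k. (-1) ^ Suc i * of_nat (k choose Suc i) * g (Suc i))
      = (\<Sum>i\<le>Suc k. (-1) ^ i * of_nat (k choose i) * g i)"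
    by (subst sum.atMost_Suc_shift) simp
  also have "\<dots> = (\<Sum>i\<le>k. (-1) ^ i * of_nat (k choose i) * g i)"
    by (simp add: binomial_eq_0)
  finally show ?thesis
    by (simp add: right_diff_distrib sum_subtractf)
qed

text \<open>Induction on the dimension. Summing over the last coordinate telescopes the
  \<open>i\<close>-th term to a difference whose lower end, shifted by \<open>n\<close>, is the
  value at \<open>Suc i\<close>; the coefficients then recombine by Pascal's rule.\<close>

lemma card_low_part:
  "int (card (low_part k n s))
    = (\<Sum>i\<le>k. (-1) ^ i * int (k choose i) * int_choose (s - int n * int i) k)"
proof (induction k arbitrary: s)
  case 0
  have "low_part 0 n s = (if s < 0 then {} else {0})"
    by (auto simp: low_part_def int_cube_0)
  then show ?case by (simp add: int_choose_def)
next
  case (Suc k)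
  let ?g = "\<lambda>i. int_choose (s - int n * int i) (Suc k)"
  have "int (card (low_part (Suc k) n s))
      = (\<Sum>j=1..n. \<Sum>i\<le>k. (-1) ^ i * int (k choose i) * int_choose (s - int j - int n * int i) k)"
    by (simp add: card_low_part_Suc Suc)
  also have "\<dots> = (\<Sum>i\<le>k. (-1) ^ i * int (k choose i) *
      (\<Sum>j=1..n. int_choose ((s - int n * int i) - int j) k))"
    by (subst sum.swap) (simp add: sum_distrib_left algebra_simps)
  also have "\<dots> = (\<Sum>i\<le>k. (-1) ^ i * int (k choose i) * (?g i - ?g (Suc i)))"
    by (simp only: sum_int_choose) (simp add: algebra_simps)
  also have "\<dots> = (\<Sum>i\<le>Suc k. (-1) ^ i * int (Suc k choose i) * ?g i)"
    by (rule alternating_binomial_sum_Suc)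
  finally show ?case .
qed

section \<open>The middle layers as a sumfree set\<close>

lemma card_le_max_sumfree:
  assumes "S \<subseteq> int_cube k n" "sumfree S"
  shows "card S \<le> max_sumfree k n"
  unfolding max_sumfree_def
proof (rule Max_ge)
  have "{card S | S. S \<subseteq> int_cube k n \<and> sumfree S} \<subseteq> card ` Pow (int_cube k n)" by auto
  then show "finite {card S | S. S \<subseteq> int_cube k n \<and> sumfree S}"
    by (rule finite_subset) (simp add: finite_int_cube)
qed (use assms in auto)

lemma max_sumfree_ge:
  assumes n: "Suc n = 3 * m"
  shows "n ^ k \<le> max_sumfree k n + 2 * card (low_part k n (int (k * m)))"
proof -
  define u where "u = int (k * m)"
  define \<sigma> :: "(nat \<Rightarrow> int) \<Rightarrow> int" where "\<sigma> = (\<lambda>x. \<Sum>i<k. x i)"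
  define S where "S = {x \<in> int_cube k n. u \<le> \<sigma> x \<and> \<sigma> x < 2 * u}"
  define H where "H = {x \<in> int_cube k n. 2 * u \<le> \<sigma> x}"
  \<comment> \<open>The reflection; the value 0 from index \<open>k\<close> on keeps the image
    inside \<open>int_cube k n\<close>.\<close>
  define r :: "(nat \<Rightarrow> int) \<Rightarrow> nat \<Rightarrow> int"
    where "r = (\<lambda>x i. if i < k then int (Suc n) - x i else 0)"
  have "sumfree S"
    unfolding sumfree_def
  proof (intro ballI notI)
    fix x y z assume xyz: "x \<in> S" "y \<in> S" "z \<in> S" and "x + y = z"
    then have "\<sigma> z = \<sigma> x + \<sigma> y" by (auto simp: \<sigma>_def sum.distrib)
    with xyz show False by (auto simp: S_def)
  qed
  then have S: "card S \<le> max_sumfree k n"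
    by (intro card_le_max_sumfree) (auto simp: S_def)
  have "inj_on r H"
  proof (rule inj_onI)
    fix x y assume xy: "x \<in> H" "y \<in> H" and eq: "r x = r y"
    show "x = y"
    proof
      fix i show "x i = y i"
        using fun_cong[OF eq, of i] xy
        by (cases "i < k") (auto simp: r_def H_def int_cube_def)
    qed
  qed
  moreover have "r ` H \<subseteq> low_part k n u"
  proof clarify
    fix x assume x: "x \<in> H"
    have "(\<Sum>i<k. r x i) = int k * int (Suc n) - \<sigma> x"
      by (simp add: r_def \<sigma>_def sum_subtractf)
    \<comment> \<open>\<open>k * (n + 1) = 3 * k * m\<close>, by the divisibility of
      \<open>n + 1\<close> by 3.\<close>
    also have "\<dots> = 3 * u - \<sigma> x"
      unfolding n u_def by simp
    also have "\<dots> \<le> u" using x by (simp add: H_def)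
    finally show "r x \<in> low_part k n u"
      using x by (fastforce simp: low_part_def H_def int_cube_def r_def)
  qed
  ultimately have H: "card H \<le> card (low_part k n u)"
    by (rule card_inj_on_le) (rule finite_low_part)
  \<comment> \<open>\<open>S\<close> and \<open>low_part k n u\<close> share the layer of sum
    \<open>u\<close>, which is harmless for an upper bound. The latter includes this layer because
    the reflection sends sum \<open>2 * u\<close> to \<open>u\<close>.\<close>
  have "int_cube k n \<subseteq> S \<union> low_part k n u \<union> H"
    by (auto simp: S_def H_def low_part_def \<sigma>_def)
  then have "card (int_cube k n) \<le> card (S \<union> low_part k n u \<union> H)"
    by (intro card_mono) (auto simp: S_def H_def finite_low_part finite_int_cube)
  also have "\<dots> \<le> card S + card (low_part k n u) + card H"
    by (meson card_Un_le add_le_mono1 order_trans)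
  finally show ?thesis
    using S H by (simp add: card_int_cube u_def)
qed

section \<open>Asymptotics of the count\<close>

text \<open>The binomial is a product of \<open>k\<close> factors \<open>a m - j\<close> over
  \<open>k!\<close>, also for \<open>a m < k\<close>, when a factor is 0. Divided by
  \<open>d m\<close>, each factor tends to \<alpha>.\<close>

lemma tendsto_binomial_over_power:
  fixes a d :: "nat \<Rightarrow> nat" and \<alpha> :: real
  assumes a: "(\<lambda>m. real (a m) / real (d m)) \<longlonglongrightarrow> \<alpha>"
    and d: "filterlim d at_top sequentially"
  shows "(\<lambda>m. real (a m choose k) / real (d m) ^ k) \<longlonglongrightarrow> \<alpha> ^ k / fact k"
proof -
  have "filterlim (\<lambda>m. real (d m)) at_top sequentially"
    by (rule filterlim_compose[OF filterlim_real_sequentially d])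
  then have "(\<lambda>m. real j / real (d m)) \<longlonglongrightarrow> 0" for j
    by (intro real_tendsto_divide_at_top[OF tendsto_const])
  then have "(\<lambda>m. real (a m) / real (d m) - real j / real (d m)) \<longlonglongrightarrow> \<alpha>" for j
    using tendsto_diff[OF a] by fastforce
  then have "(\<lambda>m. (\<Prod>j=0..<k. real (a m) / real (d m) - real j / real (d m)) / fact k)
      \<longlonglongrightarrow> (\<Prod>j=0..<k. \<alpha>) / fact k"
    by (intro tendsto_intros) auto
  then show ?thesis
    by (simp add: binomial_gbinomial gbinomial_prod_rev prod_dividef mult.commute
        flip: diff_divide_distrib)
qed

text \<open>Here \<open>n m + 1 = 3 * Suc m\<close>, so \<open>k * Suc m\<close> is the threshold of
  \<open>max_sumfree_ge\<close>. The positive part in the limit reflects the truncation in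
  \<open>int_choose\<close>.\<close>

lemma tendsto_int_choose:
  fixes k i :: nat
  assumes "k > 0"
  defines "n \<equiv> \<lambda>m. 3 * m + 2"
  shows "(\<lambda>m. real_of_int (int_choose (int (k * Suc m) - int (n m) * int i) k) / real (n m) ^ k)
    \<longlonglongrightarrow> max 0 (real k / 3 - real i) ^ k / fact k"
proof -
  define a where "a m = nat (int (k * Suc m) - int (n m) * int i)" for m
  have n: "filterlim n at_top sequentially"
    unfolding n_def filterlim_at_top
  proof
    fix Z show "\<forall>\<^sub>F m in sequentially. Z \<le> 3 * m + 2"
      using eventually_ge_at_top[of Z] by eventually_elim simp
  qed
  have "filterlim (\<lambda>m. real (n m)) at_top sequentially"
    by (rule filterlim_compose[OF filterlim_real_sequentially n])
  then have "(\<lambda>m. (real k / 3) / real (n m)) \<longlonglongrightarrow> 0"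
    by (intro real_tendsto_divide_at_top[OF tendsto_const])
  \<comment> \<open>From \<open>Suc m = (n m + 1) / 3\<close>.\<close>
  then have "(\<lambda>m. max 0 (real k / 3 + (real k / 3) / real (n m) - real i))
      \<longlonglongrightarrow> max 0 (real k / 3 + 0 - real i)"
    by (intro tendsto_intros)
  moreover have "max 0 (real k / 3 + (real k / 3) / real (n m) - real i) = real (a m) / real (n m)"
    for m
  proof -
    have pos: "real (n m) > 0" by (simp add: n_def)
    have "real k / 3 + (real k / 3) / real (n m) - real i
        = (real k * real (Suc m) - real (n m) * real i) / real (n m)"
      using pos by (simp add: field_simps) (simp add: n_def algebra_simps)
    moreover have "real (a m) = max 0 (real k * real (Suc m) - real (n m) * real i)"
    proof -
      have "real (nat t) = max 0 (real_of_int t)" for t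
        by (simp add: max_def)
      then show ?thesis unfolding a_def by (simp add: algebra_simps)
    qed
    moreover have "max 0 (t / real (n m)) = max 0 t / real (n m)" for t
      using pos by (auto simp: max_def zero_le_divide_iff)
    ultimately show ?thesis by simp
  qed
  ultimately have "(\<lambda>m. real (a m) / real (n m)) \<longlonglongrightarrow> max 0 (real k / 3 - real i)"
    by simp
  from tendsto_binomial_over_power[OF this n, of k]
  have "(\<lambda>m. real (a m choose k) / real (n m) ^ k) \<longlonglongrightarrow> max 0 (real k / 3 - real i) ^ k / fact k" .
  \<comment> \<open>At a negative argument \<open>a m\<close> is 0, and
    \<open>0 choose k = 0\<close> by \<open>k > 0\<close>, in agreement with
    \<open>int_choose\<close>.\<close>
  moreover have "real (a m choose k)
      = real_of_int (int_choose (int (k * Suc m) - int (n m) * int i) k)" for m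
    using assms(1) by (simp add: a_def int_choose_def)
  ultimately show ?thesis by simp
qed

lemma tendsto_card_low_part:
  fixes k :: nat
  assumes "k > 0"
  defines "n \<equiv> \<lambda>m. 3 * m + 2"
  shows "(\<lambda>m. real (card (low_part k (n m) (int (k * Suc m)))) / real (n m) ^ k)
    \<longlonglongrightarrow> 1 / fact k *
      (\<Sum>i = 0..nat \<lfloor>real k / 3\<rfloor>. (- 1) ^ i * real (k choose i) * (real k / 3 - real i) ^ k)"
proof -
  let ?f = "\<lambda>i. (-1) ^ i * real (k choose i)"
  have card: "real (card (low_part k n s))
      = (\<Sum>i\<le>k. ?f i * real_of_int (int_choose (s - int n * int i) k))" for n s
    using arg_cong[OF card_low_part[of k n s], of real_of_int] by simp
  have "(\<lambda>m. \<Sum>i\<le>k. ?f i *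
        (real_of_int (int_choose (int (k * Suc m) - int (n m) * int i) k) / real (n m) ^ k))
      \<longlonglongrightarrow> (\<Sum>i\<le>k. ?f i * (max 0 (real k / 3 - real i) ^ k / fact k))"
    unfolding n_def by (intro tendsto_sum tendsto_mult_left tendsto_int_choose assms)
  moreover have "(\<Sum>i\<le>k. ?f i * (max 0 (real k / 3 - real i) ^ k / fact k))
      = 1 / fact k * (\<Sum>i\<le>k. ?f i * max 0 (real k / 3 - real i) ^ k)"
    by (simp add: sum_divide_distrib)
  \<comment> \<open>Beyond \<open>k / 3\<close> the positive part is 0, and \<open>0 ^ k = 0\<close>
    by \<open>k > 0\<close>.\<close>
  moreover have "(\<Sum>i\<le>k. ?f i * max 0 (real k / 3 - real i) ^ k)
      = (\<Sum>i = 0..nat \<lfloor>real k / 3\<rfloor>. ?f i * (real k / 3 - real i) ^ k)"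
  proof (rule sum.mono_neutral_cong_right)
    show "{0..nat \<lfloor>real k / 3\<rfloor>} \<subseteq> {..k}"
      by auto linarith
    show "\<forall>i\<in>{..k} - {0..nat \<lfloor>real k / 3\<rfloor>}. ?f i * max 0 (real k / 3 - real i) ^ k = 0"
    proof
      fix i assume "i \<in> {..k} - {0..nat \<lfloor>real k / 3\<rfloor>}"
      then have "real k / 3 < real i" by simp linarith
      then show "?f i * max 0 (real k / 3 - real i) ^ k = 0"
        using assms(1) by (simp add: max_def)
    qed
    fix i assume "i \<in> {0..nat \<lfloor>real k / 3\<rfloor>}"
    then have "real i \<le> real k / 3" by simp linarith
    then show "?f i * max 0 (real k / 3 - real i) ^ k = ?f i * (real k / 3 - real i) ^ k"
      by (simp add: max_def)
  qed simp
  ultimately show ?thesis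
    by (simp add: card sum_divide_distrib)
qed

section \<open>Passage to the limit superior\<close>

theorem theorem1p1:
  fixes k :: nat
  assumes "k > 0"
  shows "c_sumfree k \<ge> ereal (1 - 2 / fact k *
    (\<Sum>i = 0..nat \<lfloor>real k / 3\<rfloor>. (- 1) ^ i * real (k choose i) * (real k / 3 - real i) ^ k))"
    (is "_ \<ge> ereal (1 - 2 / fact k * ?I)")
proof -
  \<comment> \<open>The sizes with \<open>n + 1\<close> divisible by 3 suffice: the limsup along a
    subsequence bounds the full limsup from below.\<close>
  define n where "n = (\<lambda>m::nat. 3 * m + 2)"
  define f where "f = (\<lambda>n. ereal (real (max_sumfree k n) / real n ^ k))"
  define g where
    "g m = 1 - 2 * (real (card (low_part k (n m) (int (k * Suc m)))) / real (n m) ^ k)" for m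
  have "g \<longlonglongrightarrow> 1 - 2 * (1 / fact k * ?I)"
    unfolding g_def n_def by (intro tendsto_intros tendsto_card_low_part assms)
  then have lim: "(\<lambda>m. ereal (g m)) \<longlonglongrightarrow> ereal (1 - 2 / fact k * ?I)"
    by simp
  have "ereal (1 - 2 / fact k * ?I) = limsup (\<lambda>m. ereal (g m))"
    by (rule lim_imp_Limsup[OF trivial_limit_sequentially lim, symmetric])
  also have "\<dots> \<le> limsup (f \<circ> n)"
  proof (intro Limsup_mono always_eventually allI)
    fix m
    have "real (n m ^ k)
        \<le> real (max_sumfree k (n m) + 2 * card (low_part k (n m) (int (k * Suc m))))"
      unfolding of_nat_le_iff by (rule max_sumfree_ge) (simp add: n_def)
    moreover have "real (n m) ^ k > 0" by (simp add: n_def)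
    ultimately show "ereal (g m) \<le> (f \<circ> n) m"
      by (simp add: g_def f_def pos_le_divide_eq left_diff_distrib)
  qed
  also have "\<dots> \<le> limsup f"
    by (rule limsup_subseq_mono) (simp add: n_def strict_mono_def)
  finally show ?thesis
    by (simp add: c_sumfree_def f_def)
qed

end
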